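(* Let $A\subseteq\mathbb{R}$ be an open invex subset with respect to $\eta:A\times A\to\mathbb{R}$. Let $q>1$ and let $p$ satisfy $p^{-1}+q^{-1}=1$. Suppose that $f:A\to\mathbb{R}$ is a three times differentiable function and that $|f'''|^{q}$ is prequasiinvex on $A$ with respect to $\eta$. Then for every $a,b\in A$ with $\eta(b,a)\neq 0$, $$\left|\int_{b}^{b+\eta(a,b)}f(x)\,dx-\eta(a,b)\,\frac{f(b)+f(b+\eta(a,b))}{2}-\frac{(\eta(a,b))^{2}}{12}\left[f'(b)-f'(b+\eta(a,b))\right]\right|\le\frac{(\eta(a,b))^{4}}{48}\left(\sqrt{\pi}\right)^{\frac1p}\left(\frac{\Gamma(1+p)}{\Gamma\left(\frac32+p\right)}\right)^{\frac1p}\left(\frac{1}{q+1}\right)^{\frac1q}\left[\max\left\{|f'''(a)|^{q},|f'''(b)|^{q}\right\}\right]^{\frac1q},$$ where $\Gamma$ is the Euler Gamma function.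
   Context: A set $A\subseteq\mathbb{R}$ is invex with respect to $\eta:A\times A\to\mathbb{R}$ if $u+t\,\eta(v,u)\in A$ for all $u,v\in A$ and all $t\in[0,1]$. A function $g:A\to\mathbb{R}$ on an invex set $A$ is prequasiinvex with respect to $\eta$ if $g(u+t\,\eta(v,u))\le\max\{g(u),g(v)\}$ for all $u,v\in A$ and all $t\in[0,1]$. Integrals $\int_c^d$ are oriented (the upper limit may be less than the lower limit). *)

theory Defs
  imports "HOL-Analysis.Analysis"
begin

text \<open>
  The map \<open>\<eta> : A \<times> A \<rightarrow> \<real>\<close> and functions \<open>A \<rightarrow> \<real>\<close> are represented by total functions;
  only their values for arguments in \<open>A\<close> are constrained.
\<close>

definition invex :: "real set \<Rightarrow> (real \<Rightarrow> real \<Rightarrow> real) \<Rightarrow> bool" where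
  "invex A \<eta> \<longleftrightarrow> (\<forall>u\<in>A. \<forall>v\<in>A. \<forall>t\<in>{0..1}. u + t * \<eta> v u \<in> A)"

definition prequasiinvex_on :: "real set \<Rightarrow> (real \<Rightarrow> real \<Rightarrow> real) \<Rightarrow> (real \<Rightarrow> real) \<Rightarrow> bool" where
  "prequasiinvex_on A \<eta> g \<longleftrightarrow>
     invex A \<eta> \<and> (\<forall>u\<in>A. \<forall>v\<in>A. \<forall>t\<in>{0..1}. g (u + t * \<eta> v u) \<le> max (g u) (g v))"

end

theory Submission
  imports Defs
begin

text \<open>
  Write \<open>h = \<eta>(a, b)\<close> and \<open>K t = t (2 t - 1) (1 - t) / 12\<close>. Three integrations by parts along
  \<open>t \<mapsto> b + t h\<close> identify the quantity in absolute values with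
  \<open>h\<^sup>4 \<integral>\<^sub>0\<^sup>1 K t f'''(b + t h) dt\<close>. Prequasiinvexity bounds \<open>\<bar>f'''\<bar>\<close> on the segment by
  \<open>M = max \<bar>f''' a\<bar> \<bar>f''' b\<bar>\<close>, and \<open>\<integral>\<^sub>0\<^sup>1 \<bar>K\<bar> = 1/192\<close>, so the error is at most \<open>h\<^sup>4 M / 192\<close>.

  Since \<open>f'''\<close> need not be continuous, the remainder integral is never formed: its
  antiderivative, a combination of lower derivatives, is compared with that of \<open>\<bar>K\<bar>\<close> by the
  mean value inequality (lemma \<open>corrected_trapezoid_error_unit\<close>).

  Hoelder's inequality for \<open>\<bar>K\<bar> = (t (1 - t)) \<bar>2 t - 1\<bar> / 12\<close> would give a constant of the shape
  stated in the theorem, but a direct comparison is shorter, since its \<open>p\<close>-th and \<open>q\<close>-th roots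
  are both at least \<open>1/2\<close>. For the \<open>q\<close>-th root of \<open>1 / (q + 1)\<close> this is \<open>1 + q \<le> 2\<^sup>q\<close>. In the
  \<open>p\<close>-th root, \<open>\<surd>\<pi> \<Gamma>(1 + p) / \<Gamma>(3/2 + p)\<close> is the Beta integral \<open>B(1/2, 1 + p)\<close>, which is at
  least \<open>B(1, 1 + p) = 1 / (1 + p) \<ge> 1 / 2\<^sup>p\<close>. So the right-hand side is at least
  \<open>(h\<^sup>4 / 48) (1/2) (1/2) M = h\<^sup>4 M / 192\<close>.
\<close>

section \<open>The error of the corrected trapezoidal rule\<close>

text \<open>
  The function \<open>\<Psi>\<close> in the proof is the result of integrating \<open>K g'''\<close> by parts until only
  \<open>G\<close> is left, and \<open>t\<^sup>2 (1 - t)\<^sup>2 / 24\<close> is an antiderivative of \<open>- K\<close>. As \<open>K\<close> changes sign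
  at \<open>1/2\<close> only, each half of the unit interval contributes \<open>B / 384\<close>.
\<close>

lemma corrected_trapezoid_error_unit:
  fixes G g g' g'' g''' :: "real \<Rightarrow> real"
  assumes G: "\<And>t. t \<in> {0..1} \<Longrightarrow> (G has_real_derivative g t) (at t within {0..1})"
    and g: "\<And>t. t \<in> {0..1} \<Longrightarrow> (g has_real_derivative g' t) (at t within {0..1})"
    and g': "\<And>t. t \<in> {0..1} \<Longrightarrow> (g' has_real_derivative g'' t) (at t within {0..1})"
    and g'': "\<And>t. t \<in> {0..1} \<Longrightarrow> (g'' has_real_derivative g''' t) (at t within {0..1})"
    and bound: "\<And>t. t \<in> {0..1} \<Longrightarrow> \<bar>g''' t\<bar> \<le> B"
  shows "\<bar>G 1 - G 0 - (g 0 + g 1) / 2 - (g' 0 - g' 1) / 12\<bar> \<le> B / 192"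
proof -
  define K where "K = (\<lambda>t::real. t * (2 * t - 1) * (1 - t) / 12)"
  define \<Psi> where "\<Psi> = (\<lambda>t. K t * g'' t + (6 * t^2 - 6 * t + 1) / 12 * g' t + (1/2 - t) * g t + G t)"
  define N where "N = (\<lambda>t::real. t^2 * (1 - t)^2 / 24)"
  have \<Psi>_deriv: "(\<Psi> has_real_derivative K t * g''' t) (at t within {0..1})" if "t \<in> {0..1}" for t
    unfolding \<Psi>_def K_def
    by (rule derivative_eq_intros G[OF that] g[OF that] g'[OF that] g''[OF that] refl | simp)+
       (simp add: field_simps power2_eq_square)
  have N_deriv: "(N has_real_derivative - K t) (at t within S)" for t S
    unfolding N_def K_def
    by (rule derivative_eq_intros refl | simp)+ (simp add: field_simps power2_eq_square)
  \<comment> \<open>The sign \<open>s\<close> is \<open>1\<close> on the first half, where \<open>K \<le> 0\<close>, and \<open>- 1\<close> on the second.\<close>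
  have half_bound: "\<bar>\<Psi> y - \<Psi> x\<bar> \<le> s * B * N y - s * B * N x"
    if "0 \<le> x" "x < y" "y \<le> 1" and sign: "\<And>t. x < t \<Longrightarrow> t < y \<Longrightarrow> \<bar>K t\<bar> = - s * K t" for x y s
  proof -
    have "norm (\<Psi> y - \<Psi> x) \<le> s * B * N y - s * B * N x"
    proof (rule differentiable_bound_general[where f' = "\<lambda>t. K t * g''' t"
          and \<phi>' = "\<lambda>t. s * B * (- K t)"])
      show "continuous_on {x..y} \<Psi>"
        by (rule continuous_on_subset[of "{0..1}"], rule DERIV_continuous_on, rule \<Psi>_deriv)
           (use that in auto)
      show "continuous_on {x..y} (\<lambda>t. s * B * N t)"
        unfolding N_def by (intro continuous_intros) auto
    next
      fix t assume t: "x < t" "t < y"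
      with that have t01: "0 < t" "t < 1" by auto
      then have "at t within {0..1} = at t"
        by (simp add: at_within_Icc_at)
      with \<Psi>_deriv[of t] t01 show "(\<Psi> has_vector_derivative K t * g''' t) (at t)"
        by (simp add: has_real_derivative_iff_has_vector_derivative)
      show "((\<lambda>t. s * B * N t) has_vector_derivative s * B * - K t) (at t)"
        using DERIV_cmult[OF N_deriv, of "s * B"]
        by (simp add: has_real_derivative_iff_has_vector_derivative)
      have "norm (K t * g''' t) \<le> \<bar>K t\<bar> * B"
        using bound[of t] t01 by (simp add: abs_mult mult_left_mono)
      also have "\<dots> = s * B * - K t"
        by (simp add: sign[OF t])
      finally show "norm (K t * g''' t) \<le> s * B * - K t" .
    qed (use that in auto)
    then show ?thesis by simp
  qed
  have "\<bar>\<Psi> (1/2) - \<Psi> 0\<bar> \<le> 1 * B * N (1/2) - 1 * B * N 0"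
    by (rule half_bound)
       (auto simp: K_def abs_of_nonpos mult_nonneg_nonpos mult_nonpos_nonneg)
  moreover have "\<bar>\<Psi> 1 - \<Psi> (1/2)\<bar> \<le> - 1 * B * N 1 - - 1 * B * N (1/2)"
    by (rule half_bound) (auto simp: K_def)
  moreover have "N 0 = 0" "N (1/2) = 1 / 384" "N 1 = 0"
    by (simp_all add: N_def power2_eq_square)
  ultimately have "\<bar>\<Psi> 1 - \<Psi> 0\<bar> \<le> B / 192"
    using abs_triangle_ineq[of "\<Psi> 1 - \<Psi> (1/2)" "\<Psi> (1/2) - \<Psi> 0"] by simp
  moreover have "\<Psi> 1 - \<Psi> 0 = G 1 - G 0 - (g 0 + g 1) / 2 - (g' 0 - g' 1) / 12"
    by (simp add: \<Psi>_def K_def field_simps)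
  ultimately show ?thesis
    by simp
qed

text \<open>
  The unit interval version applied to \<open>t \<mapsto> h f(b + t h)\<close>, whose third derivative is
  \<open>h\<^sup>4 f'''(b + t h)\<close>. Derivatives within the segment suffice, and \<open>h\<close> may have either sign.
\<close>

lemma corrected_trapezoid_error:
  fixes f f' f'' f''' :: "real \<Rightarrow> real" and b h :: real
  defines "S \<equiv> closed_segment b (b + h)"
  assumes f: "\<And>x. x \<in> S \<Longrightarrow> (f has_real_derivative f' x) (at x within S)"
    and f': "\<And>x. x \<in> S \<Longrightarrow> (f' has_real_derivative f'' x) (at x within S)"
    and f'': "\<And>x. x \<in> S \<Longrightarrow> (f'' has_real_derivative f''' x) (at x within S)"
    and bound: "\<And>x. x \<in> S \<Longrightarrow> \<bar>f''' x\<bar> \<le> M"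
  shows "\<bar>(LBINT x=b..b + h. f x) - h * ((f b + f (b + h)) / 2)
            - h\<^sup>2 / 12 * (f' b - f' (b + h))\<bar> \<le> h ^ 4 * M / 192"
proof -
  have path: "b + t * h \<in> S" if "t \<in> {0..1}" for t
    using that by (auto simp: S_def in_segment algebra_simps intro!: exI[of _ t])
  have along: "((\<lambda>t. F (b + t * h)) has_real_derivative F' (b + t * h) * h) (at t within {0..1})"
    if F: "\<And>x. x \<in> S \<Longrightarrow> (F has_real_derivative F' x) (at x within S)" and t: "t \<in> {0..1}"
    for F F' t
  proof -
    have "((\<lambda>t. b + t * h) has_real_derivative h) (at t within {0..1})"
      by (auto intro!: derivative_eq_intros)
    moreover have "(F has_real_derivative F' (b + t * h))
        (at (b + t * h) within (\<lambda>t. b + t * h) ` {0..1})"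
      by (rule DERIV_subset[OF F]) (use path t in auto)
    ultimately show ?thesis
      using DERIV_image_chain[of F _ "\<lambda>t. b + t * h"] by (simp add: o_def)
  qed
  define F where "F = (\<lambda>y. LBINT x=b..y. f x)"
  have S_Icc: "S = {min b (b + h)..max b (b + h)}"
    by (simp add: S_def closed_segment_eq_real_ivl)
  have cont: "continuous_on S f"
    using f by (rule DERIV_continuous_on)
  have F: "(F has_real_derivative f x) (at x within S)" if "x \<in> S" for x
    unfolding F_def has_real_derivative_iff_has_vector_derivative S_Icc
    by (rule interval_integral_FTC2) (use that cont in \<open>auto simp: S_Icc\<close>)
  have "\<bar>F (b + 1 * h) - F (b + 0 * h) - (f (b + 0 * h) * h + f (b + 1 * h) * h) / 2
        - (f' (b + 0 * h) * h * h - f' (b + 1 * h) * h * h) / 12\<bar> \<le> (M * h ^ 4) / 192"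
  proof (rule corrected_trapezoid_error_unit)
    fix t :: real assume t: "t \<in> {0..1}"
    show "((\<lambda>t. F (b + t * h)) has_real_derivative f (b + t * h) * h) (at t within {0..1})"
      by (rule along[OF F t])
    show "((\<lambda>t. f (b + t * h) * h) has_real_derivative f' (b + t * h) * h * h) (at t within {0..1})"
      by (rule DERIV_cmult_right[OF along[OF f t]])
    show "((\<lambda>t. f' (b + t * h) * h * h) has_real_derivative f'' (b + t * h) * h * h * h)
        (at t within {0..1})"
      by (intro DERIV_cmult_right along[OF f' t])
    show "((\<lambda>t. f'' (b + t * h) * h * h * h) has_real_derivative f''' (b + t * h) * h * h * h * h)
        (at t within {0..1})"
      by (intro DERIV_cmult_right along[OF f'' t])
    have "\<bar>f''' (b + t * h) * h * h * h * h\<bar> = \<bar>f''' (b + t * h)\<bar> * h ^ 4"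
      by (simp add: abs_mult power4_eq_xxxx mult.assoc)
    also have "\<dots> \<le> M * h ^ 4"
      by (rule mult_right_mono[OF bound[OF path[OF t]]]) simp
    finally show "\<bar>f''' (b + t * h) * h * h * h * h\<bar> \<le> M * h ^ 4" .
  qed
  moreover have "F b = 0"
    by (simp add: F_def)
  ultimately show ?thesis
    by (simp add: F_def algebra_simps power2_eq_square)
qed

section \<open>Lower bounds for the Hoelder factors\<close>

text \<open>
  The graph of \<open>2\<^sup>x\<close> lies above its tangent at \<open>1\<close>, whose slope \<open>2 ln 2\<close> exceeds \<open>1\<close>.
\<close>

lemma one_plus_le_two_powr:
  fixes x :: real
  assumes "x \<ge> 1"
  shows "1 + x \<le> 2 powr x"
proof -
  have "(x - 1) * (1/2) \<le> (x - 1) * ln 2"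
    using assms ln2_ge_two_thirds by (intro mult_left_mono) auto
  then have "1 + x \<le> 2 * (1 + (x - 1) * ln 2)"
    by argo
  also have "\<dots> \<le> 2 * exp ((x - 1) * ln 2)"
    using exp_ge_add_one_self by (intro mult_left_mono) auto
  also have "\<dots> = 2 powr x"
    by (simp add: powr_def left_diff_distrib exp_diff)
  finally show ?thesis .
qed

lemma half_le_inverse_one_plus_powr:
  fixes x c :: real
  assumes "x \<ge> 1" and "1 / (1 + x) \<le> c"
  shows "1/2 \<le> c powr (1 / x)"
proof -
  have "1/2 = (1 / (2 powr x)) powr (1 / x)"
    using assms(1) by (simp add: powr_divide powr_powr)
  also have "\<dots> \<le> (1 / (1 + x)) powr (1 / x)"
    using assms(1) one_plus_le_two_powr[of x] by (intro powr_mono2) (auto simp: frac_le)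
  also have "\<dots> \<le> c powr (1 / x)"
    using assms by (intro powr_mono2) auto
  finally show ?thesis .
qed

text \<open>
  This is \<open>B(1, 1 + p) \<le> B(1/2, 1 + p)\<close>. It amounts to \<open>\<Gamma>(3/2 + p) \<le> \<surd>\<pi> \<Gamma>(2 + p)\<close>, which holds because
  \<open>\<Gamma>\<close> increases on \<open>[3/2, \<infinity>)\<close> and \<open>\<surd>\<pi> \<ge> 1\<close>.
\<close>

lemma inverse_one_plus_le_Beta_half:
  fixes p :: real
  assumes "p \<ge> 0"
  shows "1 / (1 + p) \<le> sqrt pi * (Gamma (1 + p) / Gamma (3 / 2 + p))"
proof -
  have pos: "Gamma (3 / 2 + p) > 0" "Gamma (1 + p) > 0"
    using assms by (auto intro!: Gamma_real_pos add_pos_nonneg)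
  have "Gamma (3 / 2 + p) \<le> Gamma (2 + p)"
    using assms by (intro less_imp_le[OF Gamma_real_strict_mono]) auto
  also have "\<dots> = (1 + p) * Gamma (1 + p)"
  proof -
    have "1 + p \<notin> \<int>\<^sub>\<le>\<^sub>0"
      using assms by (auto dest: nonpos_Ints_nonpos)
    from Gamma_plus1[OF this] show ?thesis
      by (simp add: add_ac)
  qed
  also have "\<dots> \<le> sqrt pi * ((1 + p) * Gamma (1 + p))"
    using assms pos pi_ge_two mult_right_mono[of 1 "sqrt pi" "(1 + p) * Gamma (1 + p)"] by simp
  finally show ?thesis
    using assms pos by (simp add: field_simps)
qed

section \<open>The estimate for prequasiinvex third derivatives\<close>

theorem theorem6:
  fixes A :: "real set" and \<eta> :: "real \<Rightarrow> real \<Rightarrow> real" and f :: "real \<Rightarrow> real"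
    and p q a b :: real
  assumes "open A" and "invex A \<eta>"
    and "q > 1" and "inverse p + inverse q = 1"
    and "\<forall>k<3. (deriv ^^ k) f differentiable_on A"
    and "prequasiinvex_on A \<eta> (\<lambda>x. \<bar>(deriv ^^ 3) f x\<bar> powr q)"
    and "a \<in> A" and "b \<in> A" and "\<eta> b a \<noteq> 0"
  shows "\<bar>(LBINT x=b..b + \<eta> a b. f x)
            - \<eta> a b * ((f b + f (b + \<eta> a b)) / 2)
            - (\<eta> a b)\<^sup>2 / 12 * (deriv f b - deriv f (b + \<eta> a b))\<bar>
         \<le> (\<eta> a b) ^ 4 / 48 * sqrt pi powr (1 / p)
            * (Gamma (1 + p) / Gamma (3 / 2 + p)) powr (1 / p)
            * (1 / (q + 1)) powr (1 / q)
            * (max (\<bar>(deriv ^^ 3) f a\<bar> powr q) (\<bar>(deriv ^^ 3) f b\<bar> powr q)) powr (1 / q)"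
proof -
  define h where "h = \<eta> a b"
  define S where "S = closed_segment b (b + h)"
  define M where "M = (max (\<bar>(deriv ^^ 3) f a\<bar> powr q) (\<bar>(deriv ^^ 3) f b\<bar> powr q)) powr (1 / q)"
  define P where "P = (sqrt pi * (Gamma (1 + p) / Gamma (3 / 2 + p))) powr (1 / p)"
  define Q where "Q = (1 / (q + 1)) powr (1 / q)"
  have path: "\<exists>t\<in>{0..1}. x = b + t * \<eta> a b" if "x \<in> S" for x
    using that by (auto simp: S_def h_def in_segment algebra_simps)
  have S_A: "S \<subseteq> A"
    using path assms(2,7,8) unfolding invex_def by blast
  have deriv: "((deriv ^^ k) f has_real_derivative (deriv ^^ Suc k) f x) (at x within S)"
    if "k < 3" "x \<in> S" for k x
  proof -
    have "(deriv ^^ k) f differentiable (at x)"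
      using assms(1,5) that S_A by (auto simp: differentiable_on_eq_differentiable_at)
    then have "((deriv ^^ k) f has_real_derivative deriv ((deriv ^^ k) f) x) (at x)"
      by (simp add: DERIV_deriv_iff_real_differentiable)
    then show ?thesis
      by (auto intro: has_field_derivative_at_within)
  qed
  have third_bound: "\<bar>(deriv ^^ 3) f x\<bar> \<le> M" if "x \<in> S" for x
  proof -
    have "\<bar>(deriv ^^ 3) f x\<bar> powr q
        \<le> max (\<bar>(deriv ^^ 3) f a\<bar> powr q) (\<bar>(deriv ^^ 3) f b\<bar> powr q)"
      using path[OF that] assms(6,7,8) unfolding prequasiinvex_on_def by (metis max.commute)
    then have "(\<bar>(deriv ^^ 3) f x\<bar> powr q) powr (1 / q) \<le> M"
      unfolding M_def using assms(3) by (intro powr_mono2) auto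
    then show ?thesis
      using assms(3) by (simp add: powr_powr)
  qed
  have error: "\<bar>(LBINT x=b..b + h. f x) - h * ((f b + f (b + h)) / 2)
            - h\<^sup>2 / 12 * (deriv f b - deriv f (b + h))\<bar> \<le> h ^ 4 * M / 192"
    using deriv[of 0] deriv[of 1] deriv[of 2] third_bound unfolding S_def
    by (intro corrected_trapezoid_error[where f'' = "(deriv ^^ 2) f" and f''' = "(deriv ^^ 3) f"])
       (simp_all add: numeral_2_eq_2 numeral_3_eq_3)
  have p: "p \<ge> 1"
  proof -
    have "inverse q < 1" "inverse q > 0"
      using assms(3) by (auto simp: field_simps)
    then have "0 < inverse p" "inverse p \<le> 1"
      using assms(4) by linarith+
    then show ?thesis
      using one_le_inverse by fastforce
  qed
  have half: "1/2 \<le> P" "1/2 \<le> Q"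
    unfolding P_def Q_def using p assms(3)
    by (intro half_le_inverse_one_plus_powr inverse_one_plus_le_Beta_half; simp add: add.commute)+
  have "h ^ 4 * M / 192 = h ^ 4 / 48 * (1/2 * (1/2)) * M"
    by simp
  also have "\<dots> \<le> h ^ 4 / 48 * (P * Q) * M"
    using half by (intro mult_right_mono mult_left_mono mult_mono) (auto simp: M_def)
  also have "P = sqrt pi powr (1 / p) * (Gamma (1 + p) / Gamma (3 / 2 + p)) powr (1 / p)"
    unfolding P_def by (rule powr_mult)
  finally show ?thesis
    using error unfolding h_def M_def Q_def by (simp only: mult.assoc)
qed

end
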